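(* Let $n\ge 3$ and $r\ge 2$ be integers, and let $G$ be a finite simple connected graph with at least one edge. Let $CL_r(G)$ be the $r$-th clique-blew up iterative graph of $G$, let $N_r$ and $E_r$ be its numbers of vertices and edges, let $\mathcal{L}_r$ be its normalized Laplacian matrix, and let $\sigma_r$ be its normalized Laplacian spectrum. Then $$\sigma_r=\left\{\frac{x}{n-1}\;:\; x\in\sigma_{r-1}\setminus\{0\}\right\}\cup\left\{0,\frac{2}{n-1},\frac{n}{n-1}\right\},$$ where $m_{\mathcal{L}_r}\left(\frac{x}{n-1}\right)=m_{\mathcal{L}_{r-1}}(x)$ for $x\in\sigma_{r-1}\setminus\{0\}$, $m_{\mathcal{L}_r}(0)=1$, $m_{\mathcal{L}_r}\left(\frac{2}{n-1}\right)=E_{r-1}-N_{r-1}$, and $m_{\mathcal{L}_r}\left(\frac{n}{n-1}\right)=(n-3)E_{r-1}+N_{r-1}$.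
   Context: Clique-blew up graph: fix an integer $n\ge 3$. For a graph $G$, the graph $CL(G)$ is obtained from $G$ by adding, for every edge $e$ of $G$, $n-2$ new vertices (distinct edges receive disjoint sets of new vertices) and the edges needed so that these new vertices together with the two end-vertices of $e$ form a complete graph $K_n$. Iterates: $CL_0(G)=G$ and $CL_r(G)=CL(CL_{r-1}(G))$ for $r\ge1$ (with the same $n$ at every step). Normalized Laplacian: for a graph $H$ with all vertex degrees $d_i$ positive and adjacency matrix $A_H$, $\mathcal{L}_H$ is the matrix with entries $\mathcal{L}_H(i,j)=\delta_{ij}-\frac{A_H(i,j)}{\sqrt{d_id_j}}$. The normalized Laplacian spectrum of $H$ is the collection of eigenvalues of $\mathcal{L}_H$, considered together with their multiplicities. For a matrix $M$, $m_M(\lambda)$ denotes the multiplicity of $\lambda$ as an eigenvalue of $M$. A value listed with multiplicity $0$ is understood not to belong to the spectrum. *)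

theory Defs
  imports
    "HOL-Library.Uprod"
    "Graph_Theory.Graph_Theory"
    "Jordan_Normal_Form.Spectral_Radius"
begin

text \<open>Finite simple graphs are \<open>pair_graph\<close>s: symmetric loop-free sets of arcs. Every undirected
  edge gives two arcs, so edges are taken as unordered pairs.\<close>

definition uedges :: "'a pair_pre_digraph \<Rightarrow> 'a uprod set" where
  "uedges G = {Upair u v | u v. (u, v) \<in> parcs G}"

definition num_verts :: "'a pair_pre_digraph \<Rightarrow> nat" where
  "num_verts G = card (pverts G)"

definition num_edges :: "'a pair_pre_digraph \<Rightarrow> nat" where
  "num_edges G = card (uedges G)"

text \<open>All iterates have to live on one vertex type. \<open>Base\<close> embeds the vertices of the initial graph;
  in one blow-up step, \<open>Old v\<close> is the copy of the vertex \<open>v\<close> and \<open>New e k\<close> is the \<open>k\<close>-th new vertex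
  of the edge \<open>e\<close>. Because every step wraps the old vertices by \<open>Old\<close>, new vertices never
  coincide with those of earlier steps, although the edges of earlier steps persist.\<close>

datatype 'a blowup_vertex =
    Base 'a
  | Old "'a blowup_vertex"
  | New "'a blowup_vertex uprod" nat

definition edge_clique :: "nat \<Rightarrow> 'a blowup_vertex uprod \<Rightarrow> 'a blowup_vertex set" where
  "edge_clique n e = Old ` set_uprod e \<union> New e ` {..<n - 2}"

text \<open>The edges of the original graph survive, since \<open>edge_clique n e\<close> contains both ends of \<open>e\<close>.\<close>

definition CL ::
  "nat \<Rightarrow> 'a blowup_vertex pair_pre_digraph \<Rightarrow> 'a blowup_vertex pair_pre_digraph" where
  "CL n G = \<lparr>
     pverts = Old ` pverts G \<union> (\<Union>e\<in>uedges G. New e ` {..<n - 2}),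
     parcs = (\<Union>e\<in>uedges G. {(x, y). x \<in> edge_clique n e \<and> y \<in> edge_clique n e \<and> x \<noteq> y}) \<rparr>"

primrec CL_iter :: "nat \<Rightarrow> nat \<Rightarrow> 'a pair_pre_digraph \<Rightarrow> 'a blowup_vertex pair_pre_digraph" where
  "CL_iter n 0 G = \<lparr> pverts = Base ` pverts G, parcs = map_prod Base Base ` parcs G \<rparr>"
| "CL_iter n (Suc r) G = CL n (CL_iter n r G)"

text \<open>Matrices are indexed by \<open>{0..<N}\<close>, so some enumeration of the vertices is fixed; another one
  gives a permutation-similar matrix.\<close>

definition vertex_list :: "'a pair_pre_digraph \<Rightarrow> 'a list" where
  "vertex_list G = (SOME vs. distinct vs \<and> set vs = pverts G)"

abbreviation degree_of :: "'a pair_pre_digraph \<Rightarrow> 'a \<Rightarrow> nat" where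
  "degree_of G v \<equiv> out_degree (with_proj G) v"

definition normalized_laplacian :: "'a pair_pre_digraph \<Rightarrow> real mat" where
  "normalized_laplacian G =
     (let vs = vertex_list G in
      mat (length vs) (length vs) (\<lambda>(i, j).
        (if i = j then 1 else 0) -
        (if (vs ! i, vs ! j) \<in> parcs G then 1 else 0)
          / sqrt (real (degree_of G (vs ! i)) * real (degree_of G (vs ! j)))))"

text \<open>The algebraic multiplicity, which is the geometric one for symmetric matrices.\<close>

definition eigenvalue_mult :: "'a :: field mat \<Rightarrow> 'a \<Rightarrow> nat" where
  "eigenvalue_mult M x = Polynomial.order x (char_poly M)"

end

theory Submission
  imports Defs
begin

text \<open>
  Both \<open>H\<close> and \<open>CL n H\<close> have their edges partitioned into cliques indexed by the edges of \<open>H\<close>: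
  the edges themselves (cliques of size 2) and the added copies of $K_n$ (cliques of size \<open>n\<close>).
  Whenever the edges of a graph \<open>G\<close> are partitioned into cliques of size \<open>k\<close>, a vertex lying in
  \<open>c\<close> of them has degree \<open>(k - 1) c\<close>. Scaling the rows of the vertex-clique incidence matrix by
  \<open>1 / sqrt c\<close> therefore gives a matrix \<open>R\<close> with \<open>R R\<^sup>T = k I - (k - 1) L\<close>, where \<open>L\<close> is the normalized
  Laplacian of \<open>G\<close> (\<open>incidence_gram\<close>).

  Now \<open>R R\<^sup>T\<close> and \<open>R\<^sup>T R\<close> have the same nonzero eigenvalues with the same multiplicities, while the
  multiplicities of 0 differ by the difference of the dimensions (\<open>eigenvalue_mult_swap\<close>). Let \<open>Z\<close>
  and \<open>K\<close> be the matrices \<open>R\<close> of \<open>H\<close> and \<open>CL n H\<close>. Two different copies of $K_n$ meet only in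
  vertices of \<open>H\<close>, such a vertex lies in as many copies of $K_n$ as in edges of \<open>H\<close>, and each of
  the \<open>n - 2\<close> new vertices of a copy lies in that copy only; hence \<open>K\<^sup>T K = Z\<^sup>T Z + (n - 2) I\<close>. So the
  multiplicities pass from \<open>H\<close> to \<open>Z\<^sup>T Z\<close>, to \<open>K\<^sup>T K\<close> and to \<open>CL n H\<close>: an eigenvalue \<open>x\<close> becomes
  \<open>x / (n - 1)\<close>, and the two exchanges of factors produce the corrections at \<open>x = 2\<close> and
  \<open>x = n\<close> (\<open>eigenvalue_mult_CL\<close>).

  It remains to know the multiplicities of 2, \<open>n\<close> and 0 for the previous iterate. As \<open>R R\<^sup>T\<close> is positive
  semidefinite, \<open>L\<close> has no eigenvalue above \<open>k / (k - 1)\<close> (\<open>spectrum_le\<close>); the previous iterate is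
  itself a blow-up, so its eigenvalues are at most \<open>n / (n - 1) < 2\<close>, and 2 and \<open>n\<close> do not occur.
  The eigenvalue 0 is simple for the connected initial graph, and its multiplicity is preserved
  by every blow-up.
\<close>

section \<open>Multiplicities of eigenvalues\<close>

lemma char_poly_matrix_minus:
  fixes A :: "'a :: comm_ring_1 mat"
  assumes "A \<in> carrier_mat n n"
  shows "char_poly_matrix A = [:0, 1:] \<cdot>\<^sub>m 1\<^sub>m n - map_mat (\<lambda>a. [:a:]) A"
  using assms by (intro eq_matI) (auto simp: char_poly_matrix_def)

lemma map_const_poly_mult_mat:
  fixes A B :: "'a :: comm_ring_1 mat"
  assumes "A \<in> carrier_mat n k" "B \<in> carrier_mat k m"
  shows "map_mat (\<lambda>a. [:a:]) (A * B) = map_mat (\<lambda>a. [:a:]) A * map_mat (\<lambda>a. [:a:]) B"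
proof -
  interpret comm_ring_hom "\<lambda>a :: 'a. [:a:]"
    by unfold_locales (auto simp: one_pCons)
  show ?thesis using assms by (rule mat_hom_mult)
qed

text \<open>Sylvester's identity. With \<open>M\<close> the block matrix with rows \<open>(X I, A)\<close> and \<open>(B, I)\<close>, clearing the block
  \<open>B\<close> by column operations gives \<open>det M = char_poly (A B)\<close>, and clearing it by row operations, after
  scaling the last \<open>m\<close> rows by \<open>X\<close>, gives \<open>X\<^sup>m det M = X\<^sup>n char_poly (B A)\<close>.\<close>

lemma char_poly_mult_swap:
  fixes A B :: "'a :: idom mat"
  assumes A: "A \<in> carrier_mat n m" and B: "B \<in> carrier_mat m n"
  shows "[:0, 1:] ^ m * char_poly (A * B) = [:0, 1:] ^ n * char_poly (B * A)"
proof -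
  let ?C = "map_mat (\<lambda>a :: 'a. [:a:])" and ?X = "[:0, 1 :: 'a:]"
  let ?M = "four_block_mat (?X \<cdot>\<^sub>m 1\<^sub>m n) (?C A) (?C B) (1\<^sub>m m)"
  let ?R = "four_block_mat (1\<^sub>m n) (0\<^sub>m n m) (- ?C B) (1\<^sub>m m)"
  let ?L = "four_block_mat (1\<^sub>m n) (0\<^sub>m n m) (- ?C B) (?X \<cdot>\<^sub>m 1\<^sub>m m)"
  have c: "?C A \<in> carrier_mat n m" "?C B \<in> carrier_mat m n" using A B by auto
  have M: "?M \<in> carrier_mat (n + m) (n + m)" and R: "?R \<in> carrier_mat (n + m) (n + m)"
    and L: "?L \<in> carrier_mat (n + m) (n + m)" using c by auto
  have "?M * ?R = four_block_mat (char_poly_matrix (A * B)) (?C A) (0\<^sub>m m n) (1\<^sub>m m)"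
    by (subst mult_four_block_mat[of _ n n _ m _ m _ _ n _ m])
       (use A B c in \<open>auto simp: char_poly_matrix_minus[of _ n] map_const_poly_mult_mat
         intro!: cong_four_block_mat\<close>)
  then have "det ?M * det ?R = char_poly (A * B)"
    using A B c by (simp add: det_mult[OF M R, symmetric] char_poly_def
      det_four_block_mat_lower_left_zero[of _ n _ m])
  moreover have "det ?R = 1"
    using c by (subst det_four_block_mat_upper_right_zero[of _ n _ m]) auto
  ultimately have 1: "det ?M = char_poly (A * B)" by simp
  have "?L * ?M = four_block_mat (?X \<cdot>\<^sub>m 1\<^sub>m n) (?C A) (0\<^sub>m m n) (char_poly_matrix (B * A))"
    by (subst mult_four_block_mat[of _ n n _ m _ m _ _ n _ m])
       (use A B c in \<open>auto simp: char_poly_matrix_minus[of _ m] map_const_poly_mult_mat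
         intro!: cong_four_block_mat\<close>)
  then have "det ?L * det ?M = ?X ^ n * char_poly (B * A)"
    using A B c by (simp add: det_mult[OF L M, symmetric] char_poly_def
      det_four_block_mat_lower_left_zero[of _ n _ m])
  moreover have "det ?L = ?X ^ m"
    using c by (subst det_four_block_mat_upper_right_zero[of _ n _ m]) auto
  ultimately show ?thesis using 1 by simp
qed

text \<open>Since \<open>A B = 0\<close>, the product \<open>(X I - A) (X I - B)\<close> collapses to \<open>X (X I - (A + B))\<close>. This is the
  tool for removing an eigenvector: \<open>B\<close> will be the rank-one matrix built from a kernel vector of \<open>A\<close>.\<close>

lemma char_poly_add_of_mult_zero:
  fixes A B :: "'a :: comm_ring_1 mat"
  assumes A: "A \<in> carrier_mat n n" and B: "B \<in> carrier_mat n n" and AB: "A * B = 0\<^sub>m n n"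
  shows "char_poly A * char_poly B = [:0, 1:] ^ n * char_poly (A + B)"
proof -
  let ?C = "map_mat (\<lambda>a :: 'a. [:a:])" and ?X = "[:0, 1 :: 'a:]"
  have c: "?C A \<in> carrier_mat n n" "?C B \<in> carrier_mat n n" using A B by auto
  have 0: "?C A * ?C B = 0\<^sub>m n n"
    unfolding map_const_poly_mult_mat[OF A B, symmetric] AB by (intro eq_matI) auto
  have "char_poly_matrix A * char_poly_matrix B
      = (?X \<cdot>\<^sub>m 1\<^sub>m n - ?C A) * (?X \<cdot>\<^sub>m 1\<^sub>m n) - (?X \<cdot>\<^sub>m 1\<^sub>m n - ?C A) * ?C B"
    unfolding char_poly_matrix_minus[OF A] char_poly_matrix_minus[OF B]
    using c by (intro mult_minus_distrib_mat[of _ n n]) auto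
  also have "(?X \<cdot>\<^sub>m 1\<^sub>m n - ?C A) * (?X \<cdot>\<^sub>m 1\<^sub>m n) = ?X \<cdot>\<^sub>m (?X \<cdot>\<^sub>m 1\<^sub>m n - ?C A)"
    using c by (simp add: mult_smult_distrib[of _ n n _ n] minus_carrier_mat)
  also have "(?X \<cdot>\<^sub>m 1\<^sub>m n - ?C A) * ?C B = ?X \<cdot>\<^sub>m ?C B"
    using c 0 by (auto simp: minus_mult_distrib_mat[of _ n n] mult_smult_assoc_mat[of _ n n]
      intro!: eq_matI)
  also have "?X \<cdot>\<^sub>m (?X \<cdot>\<^sub>m 1\<^sub>m n - ?C A) - ?X \<cdot>\<^sub>m ?C B = ?X \<cdot>\<^sub>m char_poly_matrix (A + B)"
    using A B by (subst char_poly_matrix_minus[of _ n]) (auto intro!: eq_matI simp: algebra_simps)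
  finally have "det (char_poly_matrix A * char_poly_matrix B) = det (?X \<cdot>\<^sub>m char_poly_matrix (A + B))"
    by simp
  then show ?thesis
    using A B by (simp add: char_poly_def det_mult[of _ n] char_poly_matrix_def)
qed

text \<open>Substituting \<open>a + b X\<close> for \<open>X\<close> in \<open>X I - (a I + b A)\<close> leaves \<open>b (X I - A)\<close>, and substitution commutes
  with determinants.\<close>

lemma char_poly_affine:
  fixes A :: "'a :: comm_ring_1 mat"
  assumes A: "A \<in> carrier_mat n n"
  shows "pcompose (char_poly (a \<cdot>\<^sub>m 1\<^sub>m n + b \<cdot>\<^sub>m A)) [:a, b:] = Polynomial.smult (b ^ n) (char_poly A)"
proof -
  let ?c = "\<lambda>p. pcompose p [:a, b:]"
  have "map_mat ?c (char_poly_matrix (a \<cdot>\<^sub>m 1\<^sub>m n + b \<cdot>\<^sub>m A)) = [:b:] \<cdot>\<^sub>m char_poly_matrix A"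
    using A by (intro eq_matI) (auto simp: char_poly_matrix_def pcompose_pCons one_pCons)
  moreover have "comm_ring_hom ?c"
    by (rule pcompose_hom.comm_ring_hom_axioms)
  ultimately have "?c (char_poly (a \<cdot>\<^sub>m 1\<^sub>m n + b \<cdot>\<^sub>m A)) = det ([:b:] \<cdot>\<^sub>m char_poly_matrix A)"
    by (metis char_poly_def comm_ring_hom.hom_det)
  also have "\<dots> = Polynomial.smult (b ^ n) (char_poly A)"
    using A by (simp add: char_poly_def char_poly_matrix_def poly_const_pow)
  finally show ?thesis .
qed

lemma order_pcompose_linear:
  fixes p :: "'a :: field poly"
  assumes "b \<noteq> 0" "p \<noteq> 0"
  shows "order x (pcompose p [:a, b:]) = order (a + b * x) p"
proof -
  obtain q where q: "p = [:- (a + b * x), 1:] ^ order (a + b * x) p * q" and nd: "\<not> [:- (a + b * x), 1:] dvd q"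
    using order_decomp[OF assms(2)] by blast
  have nz: "poly q (a + b * x) \<noteq> 0" using nd by (simp add: poly_eq_0_iff_dvd)
  let ?m = "order (a + b * x) p"
  have "pcompose p [:a, b:] = pcompose ([:- (a + b * x), 1:] ^ ?m * q) [:a, b:]" using q by simp
  also have "\<dots> = (Polynomial.smult b [:- x, 1:]) ^ ?m * pcompose q [:a, b:]"
    by (simp add: pcompose_hom.hom_mult pcompose_hom.hom_power pcompose_pCons algebra_simps)
  also have "\<dots> = [:- x, 1:] ^ ?m * Polynomial.smult (b ^ ?m) (pcompose q [:a, b:])"
    by (simp only: smult_power mult_smult_left mult_smult_right)
  finally have eq: "pcompose p [:a, b:] = [:- x, 1:] ^ ?m * Polynomial.smult (b ^ ?m) (pcompose q [:a, b:])" .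
  have nz': "poly (Polynomial.smult (b ^ ?m) (pcompose q [:a, b:])) x \<noteq> 0"
    using nz assms by (simp add: poly_pcompose mult.commute)
  then have "Polynomial.smult (b ^ ?m) (pcompose q [:a, b:]) \<noteq> 0" by auto
  then show ?thesis unfolding eq using nz'
    by (subst order_mult) (auto simp: order_power_n_n order_0I)
qed

lemma char_poly_nonzero:
  fixes A :: "'a :: comm_ring_1 mat"
  assumes "A \<in> carrier_mat n n"
  shows "char_poly A \<noteq> 0"
  using degree_monic_char_poly[OF assms] by auto

lemma eigenvalue_mult_eq_0_iff:
  assumes "A \<in> carrier_mat n n"
  shows "eigenvalue_mult A x = 0 \<longleftrightarrow> x \<notin> spectrum A"
  unfolding eigenvalue_mult_def spectrum_root_char_poly[OF assms]
  using char_poly_nonzero[OF assms] by (simp add: order_root)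

lemma eigenvalue_mult_affine:
  fixes A :: "'a :: field mat"
  assumes A: "A \<in> carrier_mat n n" and b: "b \<noteq> 0"
  shows "eigenvalue_mult (a \<cdot>\<^sub>m 1\<^sub>m n + b \<cdot>\<^sub>m A) (a + b * x) = eigenvalue_mult A x"
proof -
  have "char_poly (a \<cdot>\<^sub>m 1\<^sub>m n + b \<cdot>\<^sub>m A) \<noteq> 0"
    using A by (intro char_poly_nonzero[of _ n]) auto
  then have "order (a + b * x) (char_poly (a \<cdot>\<^sub>m 1\<^sub>m n + b \<cdot>\<^sub>m A))
      = order x (Polynomial.smult (b ^ n) (char_poly A))"
    using b by (simp add: order_pcompose_linear[symmetric] char_poly_affine[OF A])
  then show ?thesis
    using b by (simp add: eigenvalue_mult_def order_smult)
qed

lemma order_X_power: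
  "order x ([:0, 1 :: 'a :: field:] ^ n) = (if x = 0 then n else 0)"
  using order_power_n_n[of "0 :: 'a" n] by (auto intro: order_0I)

text \<open>The conditionals carry the difference between the two dimensions, which only the eigenvalue 0 sees;
  adding on both sides avoids a truncated subtraction.\<close>

lemma eigenvalue_mult_swap:
  fixes A B :: "'a :: field mat"
  assumes A: "A \<in> carrier_mat n m" and B: "B \<in> carrier_mat m n"
  shows "(if x = 0 then m else 0) + eigenvalue_mult (A * B) x
       = (if x = 0 then n else 0) + eigenvalue_mult (B * A) x"
proof -
  have "char_poly (A * B) \<noteq> 0" "char_poly (B * A) \<noteq> 0"
    using A B char_poly_nonzero[of "A * B" n] char_poly_nonzero[of "B * A" m] by auto
  then show ?thesis
    using arg_cong[OF char_poly_mult_swap[OF A B], of "order x"]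
    by (simp add: order_mult order_X_power eigenvalue_mult_def)
qed

lemma eigenvalue_mult_add_of_mult_zero:
  fixes A B :: "'a :: field mat"
  assumes A: "A \<in> carrier_mat n n" and B: "B \<in> carrier_mat n n" and AB: "A * B = 0\<^sub>m n n"
  shows "eigenvalue_mult A x + eigenvalue_mult B x
       = (if x = 0 then n else 0) + eigenvalue_mult (A + B) x"
proof -
  have "char_poly A \<noteq> 0" "char_poly B \<noteq> 0" "char_poly (A + B) \<noteq> 0"
    using A B by (auto intro!: char_poly_nonzero[of _ n])
  then show ?thesis
    using arg_cong[OF char_poly_add_of_mult_zero[OF A B AB], of "order x"]
    by (simp add: order_mult order_X_power eigenvalue_mult_def)
qed

section \<open>Clique partitions and the normalized Laplacian\<close>

lemma vertex_list:
  assumes "finite (pverts G)"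
  shows "distinct (vertex_list G)" "set (vertex_list G) = pverts G"
    "length (vertex_list G) = num_verts G"
proof -
  have "\<exists>vs. distinct vs \<and> set vs = pverts G"
    using finite_distinct_list[OF assms] by blast
  then have *: "distinct (vertex_list G) \<and> set (vertex_list G) = pverts G"
    unfolding vertex_list_def by (rule someI_ex)
  then show "distinct (vertex_list G)" "set (vertex_list G) = pverts G" by auto
  show "length (vertex_list G) = num_verts G"
    using * by (metis distinct_card num_verts_def)
qed

lemma sum_nth_eq_sum_set:
  fixes f :: "'b \<Rightarrow> 'c :: comm_monoid_add"
  assumes "distinct xs"
  shows "(\<Sum>i<length xs. f (xs ! i)) = sum f (set xs)"
  using sum.reindex_bij_betw[OF bij_betw_nth[OF assms refl refl], of f] .

lemma degree_of_conv: "degree_of G v = card {w. (v, w) \<in> parcs G}"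
proof -
  have "out_arcs (with_proj G) v = Pair v ` {w. (v, w) \<in> parcs G}"
    by (auto simp: out_arcs_def)
  then show ?thesis by (simp add: out_degree_def card_image inj_on_def)
qed

lemma normalized_laplacian_carrier:
  assumes "finite (pverts G)"
  shows "normalized_laplacian G \<in> carrier_mat (num_verts G) (num_verts G)"
  using vertex_list(3)[OF assms] by (auto simp: normalized_laplacian_def Let_def)

lemma smult_mat_mult_vec:
  fixes A :: "'a :: comm_semiring_0 mat"
  assumes "A \<in> carrier_mat n m" "v \<in> carrier_vec m"
  shows "(c \<cdot>\<^sub>m A) *\<^sub>v v = c \<cdot>\<^sub>v (A *\<^sub>v v)"
  using assms by (intro eq_vecI) (auto simp: scalar_prod_def sum_distrib_left mult.assoc)

lemma scalar_prod_self_real: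
  fixes v :: "real vec"
  shows "v \<bullet> v \<ge> 0" "v \<in> carrier_vec n \<Longrightarrow> v \<bullet> v = 0 \<longleftrightarrow> v = 0\<^sub>v n"
proof -
  show "v \<bullet> v \<ge> 0" by (simp add: scalar_prod_def sum_nonneg)
  assume v: "v \<in> carrier_vec n"
  have "v \<bullet> v = 0 \<longleftrightarrow> (\<forall>i<n. v $ i = 0)"
    using v by (auto simp: scalar_prod_def sum_nonneg_eq_0_iff)
  then show "v \<bullet> v = 0 \<longleftrightarrow> v = 0\<^sub>v n" using v by (auto intro!: eq_vecI)
qed

text \<open>A family of cliques of the same size that covers all vertices and partitions the edges. The index type
  is separate from the vertex type because the cliques of both \<open>H\<close> and \<open>CL n H\<close> are to be indexed
  by the edges of \<open>H\<close>.\<close>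

locale clique_partition =
  fixes G :: "'a pair_pre_digraph" and I :: "'e set" and S :: "'e \<Rightarrow> 'a set" and k :: nat
  assumes finite_index: "finite I"
    and finite_verts: "finite (pverts G)"
    and clique_subset: "\<And>e. e \<in> I \<Longrightarrow> S e \<subseteq> pverts G"
    and card_clique: "\<And>e. e \<in> I \<Longrightarrow> card (S e) = k"
    and clique_size: "k \<ge> 2"
    and arcs_eq: "parcs G = (\<Union>e\<in>I. {(x, y). x \<in> S e \<and> y \<in> S e \<and> x \<noteq> y})"
    and clique_unique: "\<And>e f x y. \<lbrakk>e \<in> I; f \<in> I; x \<in> S e; y \<in> S e; x \<in> S f; y \<in> S f; x \<noteq> y\<rbrakk>
      \<Longrightarrow> e = f"
    and covered: "\<And>x. x \<in> pverts G \<Longrightarrow> \<exists>e\<in>I. x \<in> S e"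
begin

definition cliques_at :: "'a \<Rightarrow> nat" where
  "cliques_at x = card {e \<in> I. x \<in> S e}"

lemma cliques_at_pos: "x \<in> pverts G \<Longrightarrow> cliques_at x > 0"
  unfolding cliques_at_def using covered[of x] finite_index by (auto simp: card_gt_0_iff)

lemma finite_clique: "e \<in> I \<Longrightarrow> finite (S e)"
  using clique_subset finite_verts finite_subset by blast

text \<open>Two cliques through \<open>x\<close> share no other vertex, so the neighbours of \<open>x\<close> split into one batch of
  \<open>k - 1\<close> vertices for each clique through \<open>x\<close>.\<close>

lemma degree_of_eq: "degree_of G x = (k - 1) * cliques_at x"
proof -
  have "{w. (x, w) \<in> parcs G} = (\<Union>e\<in>{e \<in> I. x \<in> S e}. S e - {x})"
    unfolding arcs_eq by auto
  also have "card \<dots> = (\<Sum>e\<in>{e \<in> I. x \<in> S e}. card (S e - {x}))"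
    using finite_index finite_clique clique_unique
    by (intro card_UN_disjoint) auto
  also have "\<dots> = (\<Sum>e\<in>{e \<in> I. x \<in> S e}. k - 1)"
    using card_clique finite_clique by (intro sum.cong) auto
  finally show ?thesis by (simp add: degree_of_conv cliques_at_def)
qed

text \<open>The rows are scaled so that all diagonal entries of the Gram matrix become 1. The enumeration of the
  cliques is a parameter, so that the matrices of two graphs can share it.\<close>

definition incidence :: "'e list \<Rightarrow> real mat" where
  "incidence es = mat (num_verts G) (length es)
     (\<lambda>(i, j). if vertex_list G ! i \<in> S (es ! j)
               then 1 / sqrt (real (cliques_at (vertex_list G ! i))) else 0)"

lemma incidence_carrier: "incidence es \<in> carrier_mat (num_verts G) (length es)"
  by (simp add: incidence_def)

lemma card_common_cliques:
  assumes "x \<noteq> y"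
  shows "card {e \<in> I. x \<in> S e \<and> y \<in> S e} = (if (x, y) \<in> parcs G then 1 else 0)"
proof (cases "(x, y) \<in> parcs G")
  case True
  then obtain e where "e \<in> I" "x \<in> S e" "y \<in> S e" unfolding arcs_eq by auto
  then have "{e \<in> I. x \<in> S e \<and> y \<in> S e} = {e}" using clique_unique assms by blast
  then show ?thesis using True by simp
next
  case False
  then have "{e \<in> I. x \<in> S e \<and> y \<in> S e} = {}" using assms unfolding arcs_eq by auto
  then show ?thesis using False by (simp only: card.empty if_False)
qed

text \<open>The entry at two vertices \<open>x\<close>, \<open>y\<close> counts their common cliques, divided by \<open>sqrt (c x * c y)\<close>, where
  \<open>c\<close> counts the cliques at a vertex. The count is \<open>c x\<close> on the diagonal and the adjacency off it, and
  degrees are \<open>k - 1\<close> times the values of \<open>c\<close>.\<close>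

lemma incidence_gram:
  assumes es: "distinct es" "set es = I"
  shows "incidence es * (incidence es)\<^sup>T
       = real k \<cdot>\<^sub>m 1\<^sub>m (num_verts G) + (- (real k - 1)) \<cdot>\<^sub>m normalized_laplacian G"
proof (rule eq_matI)
  let ?vs = "vertex_list G" and ?N = "num_verts G"
  note vs = vertex_list[OF finite_verts]
  fix i i' assume "i < dim_row (real k \<cdot>\<^sub>m 1\<^sub>m ?N + (- (real k - 1)) \<cdot>\<^sub>m normalized_laplacian G)"
    and "i' < dim_col (real k \<cdot>\<^sub>m 1\<^sub>m ?N + (- (real k - 1)) \<cdot>\<^sub>m normalized_laplacian G)"
  then have i: "i < ?N" "i' < ?N"
    using normalized_laplacian_carrier[OF finite_verts] by auto
  define x y where xy: "x = ?vs ! i" "y = ?vs ! i'"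
  have V: "x \<in> pverts G" "y \<in> pverts G" using i vs unfolding xy by (metis nth_mem)+
  have pos: "real (cliques_at x) > 0" "real (cliques_at y) > 0"
    using cliques_at_pos V by auto
  have "(incidence es * (incidence es)\<^sup>T) $$ (i, i')
      = (\<Sum>j<length es. (if x \<in> S (es ! j) \<and> y \<in> S (es ! j) then 1 else 0)
            / (sqrt (cliques_at x) * sqrt (cliques_at y)))"
    using i by (auto simp: incidence_def scalar_prod_def xy atLeast0LessThan intro!: sum.cong)
  also have "\<dots> = (\<Sum>e\<in>I. (if x \<in> S e \<and> y \<in> S e then 1 else 0)
            / (sqrt (cliques_at x) * sqrt (cliques_at y)))"
    using sum_nth_eq_sum_set[OF es(1), of "\<lambda>e. (if x \<in> S e \<and> y \<in> S e then 1 else 0)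
            / (sqrt (cliques_at x) * sqrt (cliques_at y))"] es(2) by simp
  also have "\<dots> = (\<Sum>e\<in>I. if x \<in> S e \<and> y \<in> S e then 1 else 0)
            / (sqrt (cliques_at x) * sqrt (cliques_at y))"
    by (simp add: sum_divide_distrib)
  also have "(\<Sum>e\<in>I. if x \<in> S e \<and> y \<in> S e then 1 else 0) = real (card {e \<in> I. x \<in> S e \<and> y \<in> S e})"
    using finite_index by (simp add: sum.If_cases Int_def)
  finally have lhs: "(incidence es * (incidence es)\<^sup>T) $$ (i, i')
      = card {e \<in> I. x \<in> S e \<and> y \<in> S e} / (sqrt (cliques_at x) * sqrt (cliques_at y))" .
  have L: "normalized_laplacian G $$ (i, i') = (if i = i' then 1 else 0)
      - (if (x, y) \<in> parcs G then 1 else 0) / sqrt (real (degree_of G x) * real (degree_of G y))"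
    using i vs(3) by (simp add: normalized_laplacian_def Let_def xy)
  show "(incidence es * (incidence es)\<^sup>T) $$ (i, i')
      = (real k \<cdot>\<^sub>m 1\<^sub>m ?N + (- (real k - 1)) \<cdot>\<^sub>m normalized_laplacian G) $$ (i, i')"
  proof (cases "i = i'")
    case True
    then have "x = y" by (simp add: xy)
    moreover from this have "(x, y) \<notin> parcs G" unfolding arcs_eq by auto
    ultimately show ?thesis
      using True i lhs L pos normalized_laplacian_carrier[OF finite_verts]
      by (simp add: cliques_at_def)
  next
    case False
    then have "x \<noteq> y" using i vs nth_eq_iff_index_eq unfolding xy by metis
    have root: "sqrt (real (degree_of G x) * real (degree_of G y))
        = (real k - 1) * (sqrt (cliques_at x) * sqrt (cliques_at y))"
    proof -
      have "real (degree_of G x) * real (degree_of G y)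
          = (real k - 1)\<^sup>2 * (cliques_at x * cliques_at y)"
        using clique_size by (simp add: degree_of_eq power2_eq_square)
      then show ?thesis using clique_size by (simp add: real_sqrt_mult)
    qed
    have cancel: "- c * (0 - t / (c * p)) = t / p" if "c \<noteq> 0" for c t p :: real
      using that by simp
    have "(real k \<cdot>\<^sub>m 1\<^sub>m ?N + (- (real k - 1)) \<cdot>\<^sub>m normalized_laplacian G) $$ (i, i')
        = - (real k - 1) * normalized_laplacian G $$ (i, i')"
      using False i normalized_laplacian_carrier[OF finite_verts] by simp
    also have "\<dots> = (if (x, y) \<in> parcs G then 1 else 0) / (sqrt (cliques_at x) * sqrt (cliques_at y))"
      unfolding L root if_not_P[OF False] using clique_size by (intro cancel) simp
    also have "\<dots> = (incidence es * (incidence es)\<^sup>T) $$ (i, i')"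
      unfolding lhs card_common_cliques[OF \<open>x \<noteq> y\<close>] by simp
    finally show ?thesis by (rule sym)
  qed
qed (use normalized_laplacian_carrier[OF finite_verts] in \<open>auto simp: incidence_def\<close>)

lemma incidence_cogram:
  assumes es: "distinct es" "set es = I" and j: "j < length es" "j' < length es"
  shows "((incidence es)\<^sup>T * incidence es) $$ (j, j')
       = (\<Sum>x\<in>S (es ! j) \<inter> S (es ! j'). 1 / real (cliques_at x))"
proof -
  let ?vs = "vertex_list G"
  note vs = vertex_list[OF finite_verts]
  let ?f = "\<lambda>x. if x \<in> S (es ! j) \<inter> S (es ! j') then 1 / real (cliques_at x) else 0"
  have "((incidence es)\<^sup>T * incidence es) $$ (j, j') = (\<Sum>i<length ?vs. ?f (?vs ! i))"
    using j vs(3) by (auto simp: incidence_def scalar_prod_def atLeast0LessThan intro!: sum.cong)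
  also have "\<dots> = (\<Sum>x\<in>pverts G. ?f x)" by (subst sum_nth_eq_sum_set[OF vs(1)]) (simp add: vs)
  also have "\<dots> = (\<Sum>x\<in>pverts G \<inter> (S (es ! j) \<inter> S (es ! j')). 1 / real (cliques_at x))"
    using finite_verts by (simp only: sum.inter_restrict)
  also have "pverts G \<inter> (S (es ! j) \<inter> S (es ! j')) = S (es ! j) \<inter> S (es ! j')"
    using clique_subset[of "es ! j"] j es by auto
  finally show ?thesis .
qed

text \<open>The affine relation between \<open>L\<close> and \<open>R R\<^sup>T\<close> sends \<open>x\<close> to \<open>k - (k - 1) x\<close>, which vanishes exactly
  at \<open>x = k / (k - 1)\<close>; only there do the two dimensions enter.\<close>

lemma eigenvalue_mult_cogram:
  assumes es: "distinct es" "set es = I"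
  shows "(if x = real k / (real k - 1) then card I else 0) + eigenvalue_mult (normalized_laplacian G) x
       = (if x = real k / (real k - 1) then num_verts G else 0)
         + eigenvalue_mult ((incidence es)\<^sup>T * incidence es) (real k - (real k - 1) * x)"
proof -
  have "eigenvalue_mult (incidence es * (incidence es)\<^sup>T) (real k - (real k - 1) * x)
      = eigenvalue_mult (normalized_laplacian G) x"
    using eigenvalue_mult_affine[OF normalized_laplacian_carrier[OF finite_verts],
        of "- (real k - 1)" "real k" x] clique_size
    unfolding incidence_gram[OF es] by (simp only: mult_minus_left diff_conv_add_uminus)
  moreover have "real k - (real k - 1) * x = 0 \<longleftrightarrow> x = real k / (real k - 1)"
    using clique_size by (auto simp: field_simps)
  moreover have "length es = card I" using es by (metis distinct_card)
  moreover have "(incidence es)\<^sup>T \<in> carrier_mat (length es) (num_verts G)"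
    using incidence_carrier[of es] by simp
  note eigenvalue_mult_swap[OF incidence_carrier[of es] this, of "real k - (real k - 1) * x"]
  ultimately show ?thesis by (simp only:)
qed

lemma gram_quadratic_form:
  assumes u: "u \<in> carrier_vec (num_verts G)" and es: "distinct es" "set es = I"
    and ev: "normalized_laplacian G *\<^sub>v u = x \<cdot>\<^sub>v u"
  shows "((incidence es)\<^sup>T *\<^sub>v u) \<bullet> ((incidence es)\<^sup>T *\<^sub>v u) = (real k - (real k - 1) * x) * (u \<bullet> u)"
proof -
  let ?R = "incidence es" and ?N = "num_verts G" and ?L = "normalized_laplacian G"
  have R: "?R \<in> carrier_mat ?N (length es)" by (rule incidence_carrier)
  have L: "?L \<in> carrier_mat ?N ?N" by (rule normalized_laplacian_carrier[OF finite_verts])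
  have "(?R\<^sup>T *\<^sub>v u) \<bullet> (?R\<^sup>T *\<^sub>v u) = u \<bullet> (?R *\<^sub>v (?R\<^sup>T *\<^sub>v u))"
    using R u transpose_vec_mult_scalar[OF R, of "?R\<^sup>T *\<^sub>v u" u] by simp
  also have "?R *\<^sub>v (?R\<^sup>T *\<^sub>v u) = (?R * ?R\<^sup>T) *\<^sub>v u"
    using R u by (simp add: assoc_mult_mat_vec[of _ ?N "length es"])
  also have "\<dots> = real k \<cdot>\<^sub>v u + (- (real k - 1)) \<cdot>\<^sub>v (x \<cdot>\<^sub>v u)"
    unfolding incidence_gram[OF es] ev[symmetric] using L u
    by (simp add: add_mult_distrib_mat_vec[of _ ?N ?N] smult_mat_mult_vec[of _ ?N ?N])
  also have "u \<bullet> \<dots> = (real k - (real k - 1) * x) * (u \<bullet> u)"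
    using u by (simp add: scalar_prod_add_distrib[of _ ?N] algebra_simps)
  finally show ?thesis .
qed

text \<open>For an eigenvector \<open>u\<close> the quadratic form of \<open>R R\<^sup>T\<close> is the square norm of \<open>R\<^sup>T u\<close>, hence not negative.\<close>

lemma spectrum_le:
  assumes "x \<in> spectrum (normalized_laplacian G)"
  shows "x \<le> real k / (real k - 1)"
proof -
  let ?N = "num_verts G" and ?L = "normalized_laplacian G"
  have "?L \<in> carrier_mat ?N ?N" by (rule normalized_laplacian_carrier[OF finite_verts])
  then obtain u where u: "u \<in> carrier_vec ?N" "u \<noteq> 0\<^sub>v ?N" "?L *\<^sub>v u = x \<cdot>\<^sub>v u"
    using assms by (auto simp: spectrum_def eigenvalue_def eigenvector_def)
  obtain es where es: "distinct es" "set es = I"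
    using finite_distinct_list[OF finite_index] by blast
  have "(real k - (real k - 1) * x) * (u \<bullet> u) \<ge> 0"
    unfolding gram_quadratic_form[OF u(1) es u(3), symmetric] by (rule scalar_prod_self_real)
  moreover have "u \<bullet> u > 0"
    using scalar_prod_self_real(1)[of u] scalar_prod_self_real(2)[OF u(1)] u(2) by linarith
  ultimately have "real k - (real k - 1) * x \<ge> 0"
    by (simp add: zero_le_mult_iff)
  then show ?thesis using clique_size by (simp add: field_simps)
qed

lemma is_pair_graph: "pair_graph G"
proof -
  have "parcs G \<subseteq> pverts G \<times> pverts G" using clique_subset unfolding arcs_eq by blast
  moreover from this have "finite (parcs G)"
    using finite_verts by (meson finite_SigmaI finite_subset)
  moreover have "sym (parcs G)" unfolding arcs_eq sym_def by blast
  moreover have "\<And>v. (v, v) \<notin> parcs G" unfolding arcs_eq by blast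
  ultimately show ?thesis
    using finite_verts by unfold_locales (fastforce simp: symmetric_def)+
qed

lemma no_isolated: "v \<in> pverts G \<Longrightarrow> degree_of G v > 0"
  using cliques_at_pos clique_size by (simp add: degree_of_eq)

end

section \<open>The eigenvalue zero of a connected graph\<close>

text \<open>The vector \<open>w\<close> with entries \<open>sqrt (d i)\<close> spans the kernel of \<open>L\<close>: writing a kernel vector as
  \<open>y i * sqrt (d i)\<close>, twice its quadratic form is the sum of \<open>(y i - y j)\<^sup>2\<close> over the arcs, so \<open>y\<close> is constant
  along arcs. That the algebraic multiplicity is 1 follows without diagonalization, by deflation:
  \<open>L (w w\<^sup>T) = 0\<close> relates the multiplicities of 0 in \<open>L\<close>, in \<open>w w\<^sup>T\<close> (where it is \<open>N - 1\<close>) and in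
  \<open>L + w w\<^sup>T\<close>, and the last matrix is nonsingular.\<close>

lemma eigenvalue_mult_zero_of_connected:
  assumes G: "pair_graph G" and ne: "pverts G \<noteq> {}"
    and deg: "\<And>v. v \<in> pverts G \<Longrightarrow> degree_of G v > 0"
    and conn: "\<And>u v. \<lbrakk>u \<in> pverts G; v \<in> pverts G\<rbrakk> \<Longrightarrow> (u, v) \<in> (parcs G)\<^sup>*"
  shows "eigenvalue_mult (normalized_laplacian G) 0 = 1"
proof -
  interpret pair_graph G by (rule G)
  let ?vs = "vertex_list G" and ?L = "normalized_laplacian G"
  define N where "N = num_verts G"
  note vs = vertex_list[OF pair_finite_verts, folded N_def]
  have L: "?L \<in> carrier_mat N N"
    unfolding N_def by (rule normalized_laplacian_carrier[OF pair_finite_verts])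
  define a where "a i j = (if (?vs ! i, ?vs ! j) \<in> parcs G then 1 else 0 :: real)" for i j
  define d where "d i = real (degree_of G (?vs ! i))" for i
  have vin: "?vs ! i \<in> pverts G" if "i < N" for i using that vs by (metis nth_mem)
  have dpos: "d i > 0" if "i < N" for i using deg[OF vin[OF that]] by (simp add: d_def)
  have asym: "a i j = a j i" for i j using arcs_symmetric by (auto simp: a_def)
  have dsum: "(\<Sum>j<N. a i j) = d i" for i
  proof -
    have "(\<Sum>j<N. a i j) = (\<Sum>v\<in>pverts G. if (?vs ! i, v) \<in> parcs G then 1 else 0)"
      using sum_nth_eq_sum_set[OF vs(1), of "\<lambda>v. if (?vs ! i, v) \<in> parcs G then 1 else 0 :: real"]
      by (simp add: a_def vs)
    also have "\<dots> = real (card (pverts G \<inter> {v. (?vs ! i, v) \<in> parcs G}))"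
      using pair_finite_verts by (simp add: sum.If_cases)
    also have "pverts G \<inter> {v. (?vs ! i, v) \<in> parcs G} = {v. (?vs ! i, v) \<in> parcs G}"
      using in_arcsD2 by auto
    finally show ?thesis by (simp add: d_def degree_of_conv)
  qed
  \<comment> \<open>In the variables \<open>y j = u j / sqrt (d j)\<close> the rows of \<open>L\<close> become those of the combinatorial Laplacian.\<close>
  have Lu: "sqrt (d i) * (\<Sum>j<N. ?L $$ (i, j) * u j)
      = d i * (u i / sqrt (d i)) - (\<Sum>j<N. a i j * (u j / sqrt (d j)))" if i: "i < N" for u i
  proof -
    have "?L $$ (i, j) * u j
        = (if i = j then u j else 0) - a i j * (u j / sqrt (d j)) / sqrt (d i)" if "j < N" for j
      using i that vs(3)
      by (simp add: normalized_laplacian_def Let_def a_def d_def real_sqrt_mult algebra_simps)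
    then have "(\<Sum>j<N. ?L $$ (i, j) * u j)
        = (\<Sum>j<N. (if i = j then u j else 0) - a i j * (u j / sqrt (d j)) / sqrt (d i))"
      by (intro sum.cong) auto
    also have "\<dots> = u i - (\<Sum>j<N. a i j * (u j / sqrt (d j))) / sqrt (d i)"
      using i by (simp add: sum_subtractf sum_divide_distrib)
    finally have "(\<Sum>j<N. ?L $$ (i, j) * u j)
        = u i - (\<Sum>j<N. a i j * (u j / sqrt (d j))) / sqrt (d i)" .
    moreover have "d i * (u i / sqrt (d i)) = sqrt (d i) * u i"
      using real_div_sqrt[of "d i"] dpos[OF i] by (simp add: divide_simps)
    ultimately show ?thesis using dpos[OF i] by (simp add: right_diff_distrib)
  qed
  define W where "W = mat N 1 (\<lambda>(i, _). sqrt (d i))"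
  have W: "W \<in> carrier_mat N 1" by (simp add: W_def)
  define s where "s = (\<Sum>i<N. d i)"
  have "N > 0" using ne pair_finite_verts by (simp add: N_def num_verts_def card_gt_0_iff)
  then have spos: "s > 0" unfolding s_def using dpos by (intro sum_pos) auto
  have LW: "?L * W = 0\<^sub>m N 1"
  proof (rule eq_matI)
    fix i j assume ij: "i < dim_row (0\<^sub>m N 1 :: real mat)" "j < dim_col (0\<^sub>m N 1 :: real mat)"
    then have i: "i < N" by simp
    have "(\<Sum>j<N. a i j * (sqrt (d j) / sqrt (d j))) = (\<Sum>j<N. a i j)"
      by (intro sum.cong) (use dpos in force)+
    then have "sqrt (d i) * (\<Sum>j<N. ?L $$ (i, j) * sqrt (d j)) = 0"
      using Lu[OF i, of "\<lambda>j. sqrt (d j)"] dsum[of i] dpos[OF i] by simp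
    then show "(?L * W) $$ (i, j) = 0\<^sub>m N 1 $$ (i, j)"
      using ij L dpos[OF i] by (auto simp: W_def scalar_prod_def atLeast0LessThan)
  qed (use L in \<open>auto simp: W_def\<close>)
  let ?B = "W * W\<^sup>T"
  have B: "?B \<in> carrier_mat N N" using W by simp
  have "?L * ?B = 0\<^sub>m N N"
    using W L LW by (simp add: assoc_mult_mat[of _ N N _ 1 _ N, symmetric])
  from eigenvalue_mult_add_of_mult_zero[OF L B this, of 0]
  have eq1: "eigenvalue_mult ?L 0 + eigenvalue_mult ?B 0 = N + eigenvalue_mult (?L + ?B) 0"
    by simp
  \<comment> \<open>The 1 by 1 matrix \<open>W\<^sup>T W\<close> has the single entry \<open>s > 0\<close>, so \<open>W W\<^sup>T\<close> has 0 with multiplicity \<open>N - 1\<close>.\<close>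
  have "0 \<notin> spectrum (W\<^sup>T * W)"
  proof
    assume "0 \<in> spectrum (W\<^sup>T * W)"
    then obtain v where v: "v \<in> carrier_vec 1" "v \<noteq> 0\<^sub>v 1" "(W\<^sup>T * W) *\<^sub>v v = 0 \<cdot>\<^sub>v v"
      using W by (auto simp: spectrum_def eigenvalue_def eigenvector_def)
    have "((W\<^sup>T * W) *\<^sub>v v) $ 0 = s * v $ 0"
      using v(1) by (simp add: W_def scalar_prod_def s_def atLeast0LessThan abs_of_nonneg dpos less_imp_le)
    with v spos have "v $ 0 = 0" by simp
    then have "v = 0\<^sub>v 1" using v(1) by (intro eq_vecI) auto
    with v show False by simp
  qed
  then have "eigenvalue_mult (W\<^sup>T * W) 0 = 0"
    using W by (subst eigenvalue_mult_eq_0_iff[of _ 1]) auto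
  then have eq2: "1 + eigenvalue_mult ?B 0 = N"
    using eigenvalue_mult_swap[OF W, of "W\<^sup>T" 0] W by simp
  have "0 \<notin> spectrum (?L + ?B)"
  proof
    assume "0 \<in> spectrum (?L + ?B)"
    then obtain v where v: "v \<in> carrier_vec N" "v \<noteq> 0\<^sub>v N" and ev: "(?L + ?B) *\<^sub>v v = 0 \<cdot>\<^sub>v v"
      using L B by (auto simp: spectrum_def eigenvalue_def eigenvector_def)
    define y where "y j = v $ j / sqrt (d j)" for j
    define c where "c = (\<Sum>j<N. sqrt (d j) * v $ j)"
    have row: "(\<Sum>j<N. ?L $$ (i, j) * v $ j) + sqrt (d i) * c = 0" if i: "i < N" for i
    proof -
      have "((?L + ?B) *\<^sub>v v) $ i = (\<Sum>j<N. (?L $$ (i, j) + sqrt (d i) * sqrt (d j)) * v $ j)"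
        using i v L by (auto simp: scalar_prod_def W_def atLeast0LessThan intro!: sum.cong)
      also have "\<dots> = (\<Sum>j<N. ?L $$ (i, j) * v $ j) + sqrt (d i) * c"
        by (simp add: c_def sum_distrib_left sum.distrib algebra_simps)
      finally show ?thesis using ev i v by simp
    qed
    have yrow: "d i * y i - (\<Sum>j<N. a i j * y j) + d i * c = 0" if i: "i < N" for i
      using arg_cong[OF row[OF i], of "\<lambda>x. sqrt (d i) * x"] Lu[OF i, of "\<lambda>j. v $ j"] dpos[OF i]
      by (simp add: y_def distrib_left mult.assoc[symmetric])
    have swap: "(\<Sum>i<N. \<Sum>j<N. a i j * f i j) = (\<Sum>i<N. \<Sum>j<N. a i j * f j i)" for f
      by (subst sum.swap) (simp add: asym)
    have dy: "(\<Sum>i<N. d i * g i) = (\<Sum>i<N. \<Sum>j<N. a i j * g i)" for g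
      by (simp add: dsum[symmetric] sum_distrib_right)
    \<comment> \<open>Summing the rows kills the Laplacian part by symmetry, so \<open>v\<close> is orthogonal to \<open>w\<close>.\<close>
    have "0 = (\<Sum>i<N. d i * y i - (\<Sum>j<N. a i j * y j) + d i * c)"
      using yrow by (simp add: sum.neutral)
    also have "\<dots> = (\<Sum>i<N. d i * y i) - (\<Sum>i<N. \<Sum>j<N. a i j * y j) + s * c"
      by (simp add: sum.distrib sum_subtractf s_def sum_distrib_right)
    also have "(\<Sum>i<N. d i * y i) = (\<Sum>i<N. \<Sum>j<N. a i j * y j)"
      using dy[of y] swap[of "\<lambda>i j. y i"] by simp
    finally have c0: "c = 0" using spos by simp
    have "(\<Sum>i<N. \<Sum>j<N. a i j * (y i - y j)\<^sup>2)
        = (\<Sum>i<N. \<Sum>j<N. a i j * (y i)\<^sup>2) + (\<Sum>i<N. \<Sum>j<N. a i j * (y j)\<^sup>2)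
          - 2 * (\<Sum>i<N. \<Sum>j<N. a i j * (y i * y j))"
      by (simp add: power2_diff algebra_simps sum.distrib sum_subtractf sum_distrib_left)
    also have "\<dots> = 2 * (\<Sum>i<N. y i * (d i * y i - (\<Sum>j<N. a i j * y j)))"
      using dy[of "\<lambda>i. (y i)\<^sup>2"] swap[of "\<lambda>i j. (y i)\<^sup>2"]
      by (simp add: power2_eq_square algebra_simps sum.distrib sum_subtractf sum_distrib_left)
    also have "\<dots> = 0" using yrow c0 by (simp add: sum.neutral)
    finally have sq0: "(\<Sum>i<N. \<Sum>j<N. a i j * (y i - y j)\<^sup>2) = 0" .
    have sq: "a i j * (y i - y j)\<^sup>2 = 0" if "i < N" "j < N" for i j
    proof -
      have nn: "a i j * (y i - y j)\<^sup>2 \<ge> 0" for i j by (simp add: a_def)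
      from sq0 have "(\<Sum>j<N. a i j * (y i - y j)\<^sup>2) = 0"
        using that nn by (subst (asm) sum_nonneg_eq_0_iff) (auto intro: sum_nonneg)
      then show ?thesis using that nn by (subst (asm) sum_nonneg_eq_0_iff) auto
    qed
    have reach: "\<forall>j<N. w = ?vs ! j \<longrightarrow> y j = y 0" if "(?vs ! 0, w) \<in> (parcs G)\<^sup>*" for w
      using that
    proof (induction rule: rtrancl_induct)
      case base
      then show ?case using vs \<open>N > 0\<close> by (metis nth_eq_iff_index_eq)
    next
      case (step w w')
      obtain i where i: "i < N" "w = ?vs ! i"
        using in_arcsD1[OF step(2)] vs by (metis in_set_conv_nth)
      show ?case
      proof (intro allI impI)
        fix j assume j: "j < N" "w' = ?vs ! j"
        have "a i j = 1" using step(2) i j by (simp add: a_def)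
        then show "y j = y 0" using sq[OF i(1) j(1)] step.IH i by simp
      qed
    qed
    have yc: "y j = y 0" if "j < N" for j
      using reach[OF conn[OF vin[OF \<open>N > 0\<close>] vin[OF that]]] that by blast
    have "c = (\<Sum>j<N. d j * y j)"
    proof -
      have "sqrt (d j) * v $ j = d j * y j" if "j < N" for j
        using real_div_sqrt[of "d j"] dpos[OF that] by (simp add: y_def divide_simps)
      then show ?thesis unfolding c_def by (intro sum.cong) auto
    qed
    also have "\<dots> = (\<Sum>j<N. d j * y 0)"
      by (intro sum.cong refl arg_cong[where f = "\<lambda>t. _ * t"]) (erule yc[OF lessThan_iff[THEN iffD1]])
    also have "\<dots> = s * y 0" by (simp add: s_def sum_distrib_right)
    finally have y0: "y 0 = 0" using c0 spos by simp
    have "v $ j = 0" if "j < N" for j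
    proof -
      have "y j = 0" using yc[OF that] y0 by (rule trans)
      then show ?thesis using dpos[OF that] by (simp add: y_def)
    qed
    then have "v = 0\<^sub>v N" using v(1) by (intro eq_vecI) auto
    with v show False by simp
  qed
  then have "eigenvalue_mult (?L + ?B) 0 = 0"
    using L B by (subst eigenvalue_mult_eq_0_iff[of _ N]) auto
  with eq1 eq2 show ?thesis by simp
qed

section \<open>The spectrum of a blow-up\<close>

lemma mem_uedgesE:
  assumes "e \<in> uedges H"
  obtains u v where "e = Upair u v" "(u, v) \<in> parcs H"
  using assms by (auto simp: uedges_def)

lemma edges_clique_partition:
  assumes H: "pair_graph H" and deg: "\<And>v. v \<in> pverts H \<Longrightarrow> degree_of H v > 0"
  shows "clique_partition H (uedges H) set_uprod 2"
proof -
  interpret pair_graph H by (rule H)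
  show ?thesis
  proof
    have "uedges H = (\<lambda>(u, v). Upair u v) ` parcs H" by (auto simp: uedges_def)
    then show "finite (uedges H)" using pair_finite_arcs by simp
    show "parcs H = (\<Union>e\<in>uedges H. {(x, y). x \<in> set_uprod e \<and> y \<in> set_uprod e \<and> x \<noteq> y})"
    proof
      show "parcs H \<subseteq> (\<Union>e\<in>uedges H. {(x, y). x \<in> set_uprod e \<and> y \<in> set_uprod e \<and> x \<noteq> y})"
      proof clarify
        fix u v assume "(u, v) \<in> parcs H"
        then have "Upair u v \<in> uedges H" "u \<noteq> v" using no_loops' by (auto simp: uedges_def)
        then show "(u, v) \<in> (\<Union>e\<in>uedges H. {(x, y). x \<in> set_uprod e \<and> y \<in> set_uprod e \<and> x \<noteq> y})"
          by (intro UN_I[of "Upair u v"]) auto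
      qed
    qed (auto elim!: mem_uedgesE intro: arcs_symmetric)
    show "\<exists>e\<in>uedges H. x \<in> set_uprod e" if x: "x \<in> pverts H" for x
    proof -
      have "{w. (x, w) \<in> parcs H} \<noteq> {}" using deg[OF x] unfolding degree_of_conv by (metis card.empty less_irrefl)
      then obtain w where "(x, w) \<in> parcs H" by blast
      then have "Upair x w \<in> uedges H" by (auto simp: uedges_def)
      then show ?thesis by (intro bexI[of _ "Upair x w"]) auto
    qed
    show "e = f" if "e \<in> uedges H" "f \<in> uedges H" "x \<in> set_uprod e" "y \<in> set_uprod e"
      "x \<in> set_uprod f" "y \<in> set_uprod f" "x \<noteq> y" for e f x y
      using that by (cases e; cases f) auto
  qed (auto simp: pair_finite_verts dest: in_arcsD1 in_arcsD2 no_loops' elim!: mem_uedgesE)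
qed

text \<open>Two copies of $K_n$ can share only old vertices, and two old vertices determine the edge of \<open>H\<close>.\<close>

lemma CL_clique_partition:
  assumes H: "clique_partition H (uedges H) set_uprod 2" and n: "n \<ge> 2"
  shows "clique_partition (CL n H) (uedges H) (edge_clique n) n"
proof -
  interpret H: clique_partition H "uedges H" set_uprod 2 by (rule H)
  show ?thesis
  proof
    show "finite (uedges H)" by (rule H.finite_index)
    then show "finite (pverts (CL n H))" using H.finite_verts by (simp add: CL_def)
    show "edge_clique n e \<subseteq> pverts (CL n H)" if "e \<in> uedges H" for e
      using H.clique_subset[OF that] that by (auto simp: edge_clique_def CL_def)
    show "card (edge_clique n e) = n" if "e \<in> uedges H" for e
    proof -
      have "card (edge_clique n e) = card (Old ` set_uprod e) + card (New e ` {..<n - 2})"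
        unfolding edge_clique_def by (intro card_Un_disjoint) auto
      then show ?thesis
        using H.card_clique[OF that] n by (simp add: card_image inj_on_def)
    qed
    show "\<exists>e\<in>uedges H. x \<in> edge_clique n e" if "x \<in> pverts (CL n H)" for x
    proof -
      consider v where "v \<in> pverts H" "x = Old v"
        | e i where "e \<in> uedges H" "i < n - 2" "x = New e i"
        using \<open>x \<in> pverts (CL n H)\<close> by (auto simp: CL_def)
      then show ?thesis
      proof cases
        case 1
        then show ?thesis using H.covered[of v] by (auto simp: edge_clique_def)
      qed (auto simp: edge_clique_def)
    qed
    show "e = f" if ef: "e \<in> uedges H" "f \<in> uedges H" and
      xy: "x \<in> edge_clique n e" "y \<in> edge_clique n e" "x \<in> edge_clique n f" "y \<in> edge_clique n f"
        "x \<noteq> y" for e f x y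
      using xy H.clique_unique[OF ef] by (auto simp: edge_clique_def)
  qed (auto simp: CL_def n)
qed

lemma num_verts_CL:
  assumes "finite (pverts H)" "finite (uedges H)"
  shows "num_verts (CL n H) = num_verts H + (n - 2) * num_edges H"
proof -
  have "num_verts (CL n H)
      = card (Old ` pverts H) + card (\<Union>e\<in>uedges H. New e ` {..<n - 2})"
    unfolding num_verts_def CL_def using assms
    by (simp, intro card_Un_disjoint) auto
  also have "card (\<Union>e\<in>uedges H. New e ` {..<n - 2}) = (\<Sum>e\<in>uedges H. card (New e ` {..<n - 2}))"
    using assms by (intro card_UN_disjoint) auto
  finally show ?thesis
    by (simp add: card_image inj_on_def num_verts_def num_edges_def)
qed

text \<open>One blow-up step, for all eigenvalues at once. The terms at \<open>x = 2\<close> come from exchanging the factors of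
  \<open>Z Z\<^sup>T\<close>, those at \<open>x = n\<close> from exchanging the factors of \<open>K K\<^sup>T\<close>.\<close>

lemma eigenvalue_mult_CL:
  assumes H: "pair_graph H" and deg: "\<And>v. v \<in> pverts H \<Longrightarrow> degree_of H v > 0" and n: "n \<ge> 2"
  shows "eigenvalue_mult (normalized_laplacian (CL n H)) (x / (real n - 1))
         + (if x = real n then num_edges H else 0) + (if x = 2 then num_verts H else 0)
       = eigenvalue_mult (normalized_laplacian H) x
         + (if x = real n then num_verts H + (n - 2) * num_edges H else 0)
         + (if x = 2 then num_edges H else 0)"
proof -
  note EP = edges_clique_partition[OF H deg]
  interpret E: clique_partition H "uedges H" set_uprod 2 by (rule EP)
  interpret C: clique_partition "CL n H" "uedges H" "edge_clique n" n
    by (rule CL_clique_partition[OF EP n])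
  obtain es where es: "distinct es" "set es = uedges H"
    using finite_distinct_list[OF E.finite_index] by blast
  let ?Z = "E.incidence es" and ?K = "C.incidence es" and ?m = "length es"
  have Z: "?Z \<in> carrier_mat (num_verts H) ?m" by (rule E.incidence_carrier)
  have K: "?K \<in> carrier_mat (num_verts (CL n H)) ?m" by (rule C.incidence_carrier)
  have old: "C.cliques_at (Old v) = E.cliques_at v" for v
    unfolding C.cliques_at_def E.cliques_at_def
    by (intro arg_cong[where f = card]) (auto simp: edge_clique_def)
  have new: "C.cliques_at (New e i) = 1" if "e \<in> uedges H" "i < n - 2" for e i
  proof -
    have "{f \<in> uedges H. New e i \<in> edge_clique n f} = {e}"
      using that by (auto simp: edge_clique_def)
    then show ?thesis by (simp add: C.cliques_at_def)
  qed
  \<comment> \<open>The factor 1 brings the right-hand side into the form \<open>a I + b A\<close> of an affine image.\<close>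
  have "?K\<^sup>T * ?K = real (n - 2) \<cdot>\<^sub>m 1\<^sub>m ?m + 1 \<cdot>\<^sub>m (?Z\<^sup>T * ?Z)"
  proof (rule eq_matI)
    fix j j' assume "j < dim_row (real (n - 2) \<cdot>\<^sub>m 1\<^sub>m ?m + 1 \<cdot>\<^sub>m (?Z\<^sup>T * ?Z))"
      and "j' < dim_col (real (n - 2) \<cdot>\<^sub>m 1\<^sub>m ?m + 1 \<cdot>\<^sub>m (?Z\<^sup>T * ?Z))"
    then have j: "j < ?m" "j' < ?m" using Z by auto
    define e f where ef: "e = es ! j" "f = es ! j'"
    have e: "e \<in> uedges H" using nth_mem[OF j(1)] es(2) ef(1) by simp
    have eqf: "e = f \<longleftrightarrow> j = j'" unfolding ef using j es(1) by (rule nth_eq_iff_index_eq[rotated])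
    let ?w = "\<lambda>x. 1 / real (C.cliques_at x)" and ?T = "if e = f then New e ` {..<n - 2} else {}"
    have "(?K\<^sup>T * ?K) $$ (j, j') = sum ?w (edge_clique n e \<inter> edge_clique n f)"
      unfolding ef by (rule C.incidence_cogram[OF es j])
    also have "edge_clique n e \<inter> edge_clique n f = Old ` (set_uprod e \<inter> set_uprod f) \<union> ?T"
      by (auto simp: edge_clique_def)
    also have "sum ?w \<dots> = sum ?w (Old ` (set_uprod e \<inter> set_uprod f)) + sum ?w ?T"
      by (intro sum.union_disjoint) auto
    also have "sum ?w (Old ` (set_uprod e \<inter> set_uprod f))
        = (\<Sum>v\<in>set_uprod e \<inter> set_uprod f. 1 / real (E.cliques_at v))"
      by (subst sum.reindex) (auto simp: inj_on_def old)
    also have "\<dots> = (?Z\<^sup>T * ?Z) $$ (j, j')"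
      unfolding ef by (rule E.incidence_cogram[OF es j, symmetric])
    also have "sum ?w ?T = (if e = f then real (n - 2) else 0)"
      by (cases "e = f") (use e in \<open>auto simp: sum.reindex inj_on_def new\<close>)
    finally show "(?K\<^sup>T * ?K) $$ (j, j')
        = (real (n - 2) \<cdot>\<^sub>m 1\<^sub>m ?m + 1 \<cdot>\<^sub>m (?Z\<^sup>T * ?Z)) $$ (j, j')"
      using j Z eqf by simp
  qed (use K Z in auto)
  then have "eigenvalue_mult (?K\<^sup>T * ?K) (real (n - 2) + 1 * (2 - x))
      = eigenvalue_mult (?Z\<^sup>T * ?Z) (2 - x)"
    using Z by (simp only:) (rule eigenvalue_mult_affine, auto)
  moreover have "real (n - 2) + 1 * (2 - x) = real n - (real n - 1) * (x / (real n - 1))"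
    using n by (simp add: of_nat_diff)
  ultimately have KZ: "eigenvalue_mult (?K\<^sup>T * ?K) (real n - (real n - 1) * (x / (real n - 1)))
      = eigenvalue_mult (?Z\<^sup>T * ?Z) (2 - x)" by simp
  have "x / (real n - 1) = real n / (real n - 1) \<longleftrightarrow> x = real n" using n by simp
  note multC = C.eigenvalue_mult_cogram[OF es, of "x / (real n - 1)", unfolded this KZ
      num_verts_CL[OF E.finite_verts E.finite_index], folded num_edges_def]
  have "x = real 2 / (real 2 - 1) \<longleftrightarrow> x = 2" "real 2 - (real 2 - 1) * x = 2 - x" by simp_all
  note multE = E.eigenvalue_mult_cogram[OF es, of x, unfolded this, folded num_edges_def]
  show ?thesis using multC multE by linarith
qed

section \<open>Iterated blow-ups\<close>

lemma CL_iter_0_properties: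
  assumes G: "pair_graph G" and conn: "Digraph_Component.connected (with_proj G)"
    and edge: "uedges G \<noteq> {}"
  shows "pair_graph (CL_iter n 0 G)"
    "\<And>v. v \<in> pverts (CL_iter n 0 G) \<Longrightarrow> degree_of (CL_iter n 0 G) v > 0"
    "eigenvalue_mult (normalized_laplacian (CL_iter n 0 G)) 0 = 1"
    "num_verts (CL_iter n 0 G) > 0"
proof -
  interpret pair_graph G by (rule G)
  let ?G = "CL_iter n 0 G"
  show G0: "pair_graph ?G"
    using pair_finite_verts pair_finite_arcs in_arcsD1 in_arcsD2 no_loops' arcs_symmetric
    by unfold_locales (auto simp: symmetric_def sym_def)
  have reach: "(u, v) \<in> (parcs G)\<^sup>*" if "u \<in> pverts G" "v \<in> pverts G" for u v
  proof -
    have "parcs (mk_symmetric (with_proj G)) = parcs G"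
      using arcs_symmetric by (auto simp: mk_symmetric_def)
    moreover have "u \<rightarrow>\<^sup>*\<^bsub>with_proj (mk_symmetric (with_proj G))\<^esub> v"
      using conn that by (auto simp: connected_def strongly_connected_def mk_symmetric_def)
    ultimately show ?thesis using reachable_rtranclI by fastforce
  qed
  have "(Base u, Base v) \<in> (parcs ?G)\<^sup>*" if "u \<in> pverts G" "v \<in> pverts G" for u v
    using reach[OF that]
  proof (induction rule: rtrancl_induct)
    case (step v w)
    then have "(Base v, Base w) \<in> parcs ?G" by force
    with step.IH show ?case by (rule rtrancl_into_rtrancl)
  qed auto
  then have reach': "(u, v) \<in> (parcs ?G)\<^sup>*" if "u \<in> pverts ?G" "v \<in> pverts ?G" for u v
    using that by auto
  obtain a b where ab: "(a, b) \<in> parcs G" using edge by (auto simp: uedges_def)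
  show deg: "degree_of ?G v > 0" if v: "v \<in> pverts ?G" for v
  proof -
    interpret G0: pair_graph ?G by (rule G0)
    have ab': "Base a \<in> pverts ?G" "Base b \<in> pverts ?G" "Base a \<noteq> Base b"
      using ab in_arcsD1 in_arcsD2 no_loops' by auto
    then obtain w where "w \<in> pverts ?G" "w \<noteq> v" by metis
    then obtain w' where "(v, w') \<in> parcs ?G"
      using reach'[OF v] by (metis converse_rtranclE)
    moreover have "finite {w. (v, w) \<in> parcs ?G}"
      using G0.in_arcsD2 by (intro finite_subset[OF _ G0.pair_finite_verts]) auto
    ultimately show ?thesis unfolding degree_of_conv by (auto simp: card_gt_0_iff)
  qed
  have ne: "pverts ?G \<noteq> {}" using ab in_arcsD1 by auto
  show "eigenvalue_mult (normalized_laplacian ?G) 0 = 1"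
    by (rule eigenvalue_mult_zero_of_connected[OF G0 ne deg reach'])
  show "num_verts ?G > 0" using ne pair_finite_verts by (auto simp: num_verts_def card_gt_0_iff)
qed

text \<open>A blow-up preserves the multiplicity of 0 because 0 differs from the exceptional values 2 and \<open>n\<close>,
  so the simplicity that connectedness gives for the initial graph passes to all iterates.\<close>

lemma CL_iter_properties:
  assumes G: "pair_graph G" and conn: "Digraph_Component.connected (with_proj G)"
    and edge: "uedges G \<noteq> {}" and n: "n \<ge> 3"
  shows "pair_graph (CL_iter n r G) \<and> (\<forall>v \<in> pverts (CL_iter n r G). degree_of (CL_iter n r G) v > 0)
    \<and> eigenvalue_mult (normalized_laplacian (CL_iter n r G)) 0 = 1
    \<and> num_verts (CL_iter n r G) > 0"
proof (induction r)
  case 0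
  show ?case using CL_iter_0_properties[OF G conn edge] by blast
next
  case (Suc r)
  let ?H = "CL_iter n r G"
  have H: "pair_graph ?H" "\<And>v. v \<in> pverts ?H \<Longrightarrow> degree_of ?H v > 0" using Suc by auto
  have n2: "n \<ge> 2" using n by simp
  note EP = edges_clique_partition[OF H]
  interpret E: clique_partition ?H "uedges ?H" set_uprod 2 by (rule EP)
  interpret C: clique_partition "CL n ?H" "uedges ?H" "edge_clique n" n
    by (rule CL_clique_partition[OF EP n2])
  have "eigenvalue_mult (normalized_laplacian (CL n ?H)) 0 = 1"
    using eigenvalue_mult_CL[OF H n2, of 0] Suc n by simp
  then show ?case
    using C.is_pair_graph C.no_isolated Suc num_verts_CL[OF E.finite_verts E.finite_index] by simp
qed

theorem theorem4p1:
  fixes G :: "'a pair_pre_digraph" and n r :: nat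
  assumes n: "n \<ge> 3" and r: "r \<ge> 2"
    and simple: "pair_graph G"
    and conn: "Digraph_Component.connected (with_proj G)"
    and edge: "uedges G \<noteq> {}"
  shows
    "let H = CL_iter n (r - 1) G; L' = normalized_laplacian H; N' = num_verts H; E' = num_edges H;
         L = normalized_laplacian (CL_iter n r G)
     in
       spectrum L =
         {x / (real n - 1) | x. x \<in> spectrum L' - {0}} \<union> {0, real n / (real n - 1)}
           \<union> (if E' = N' then {} else {2 / (real n - 1)})
     \<and> (\<forall>x \<in> spectrum L' - {0}. eigenvalue_mult L (x / (real n - 1)) = eigenvalue_mult L' x)
     \<and> eigenvalue_mult L 0 = 1
     \<and> int (eigenvalue_mult L (2 / (real n - 1))) = int E' - int N'
     \<and> eigenvalue_mult L (real n / (real n - 1)) = (n - 3) * E' + N'"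
proof -
  obtain q where q: "r = Suc (Suc q)" using r by (metis add_2_eq_Suc le_Suc_ex)
  define H where "H = CL_iter n (Suc q) G"
  define L where "L = normalized_laplacian (CL n H)"
  define L' where "L' = normalized_laplacian H"
  define N' where "N' = num_verts H"
  define E' where "E' = num_edges H"
  have n2: "n \<ge> 2" using n by simp
  note props = CL_iter_properties[OF simple conn edge n]
  have H: "pair_graph H" "\<And>v. v \<in> pverts H \<Longrightarrow> degree_of H v > 0"
    and N': "N' > 0"
    using props[of "Suc q"] unfolding H_def N'_def by auto
  have finH: "finite (pverts H)" and finL: "finite (pverts (CL n H))"
    and m0: "eigenvalue_mult L 0 = 1"
    using props[of "Suc q"] props[of "Suc (Suc q)"] unfolding H_def L_def
    by (auto simp: pair_graph_def pair_digraph_def pair_fin_digraph_def pair_fin_digraph_axioms_def)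
  have specL: "x \<in> spectrum L \<longleftrightarrow> eigenvalue_mult L x \<noteq> 0" for x
    unfolding L_def using eigenvalue_mult_eq_0_iff[OF normalized_laplacian_carrier[OF finL]] by simp
  have specL': "x \<in> spectrum L' \<longleftrightarrow> eigenvalue_mult L' x \<noteq> 0" for x
    unfolding L'_def using eigenvalue_mult_eq_0_iff[OF normalized_laplacian_carrier[OF finH]] by simp
  \<comment> \<open>As \<open>r \<ge> 2\<close>, the graph \<open>H\<close> is itself a blow-up, which keeps its eigenvalues below 2.\<close>
  have "clique_partition H (uedges (CL_iter n q G)) (edge_clique n) n"
    using props[of q] unfolding H_def
    by (auto intro!: CL_clique_partition edges_clique_partition n2)
  then have le: "x \<le> real n / (real n - 1)" if "x \<in> spectrum L'" for x
    using clique_partition.spectrum_le that unfolding L'_def by blast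
  have small: "real n / (real n - 1) < 2" using n by (simp add: field_simps)
  have no2: "eigenvalue_mult L' 2 = 0" using le[of 2] small specL'[of 2] by linarith
  have non: "eigenvalue_mult L' (real n) = 0"
    using le[of "real n"] small n specL'[of "real n"] by linarith
  note step = eigenvalue_mult_CL[OF H n2, folded L_def L'_def N'_def E'_def]
  have gen: "eigenvalue_mult L (x / (real n - 1)) = eigenvalue_mult L' x"
    if "x \<noteq> 2" "x \<noteq> real n" for x
    using step[of x] that by simp
  have m2: "eigenvalue_mult L (2 / (real n - 1)) + N' = E'"
    using step[of 2] no2 n by simp
  have "eigenvalue_mult L (real n / (real n - 1)) + E' = N' + (n - 2) * E'"
    using step[of "real n"] non n by simp
  moreover have "n - 2 = Suc (n - 3)" using n by arith
  ultimately have mn: "eigenvalue_mult L (real n / (real n - 1)) = (n - 3) * E' + N'" by simp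
  have spec: "spectrum L = {x / (real n - 1) | x. x \<in> spectrum L' - {0}} \<union> {0, real n / (real n - 1)}
           \<union> (if E' = N' then {} else {2 / (real n - 1)})" (is "_ = ?R")
  proof (rule Set.set_eqI)
    fix t
    define x where "x = (real n - 1) * t"
    have t: "t = x / (real n - 1)" using n by (simp add: x_def)
    have inj: "x / (real n - 1) = y / (real n - 1) \<longleftrightarrow> x = y" for y using n by simp
    have R: "t \<in> ?R \<longleftrightarrow> (x \<in> spectrum L' \<and> x \<noteq> 0) \<or> x = 0 \<or> x = real n \<or> (x = 2 \<and> E' \<noteq> N')"
      unfolding t using inj n by auto
    consider "x = 2" | "x = real n" | "x \<noteq> 2" "x \<noteq> real n" by blast
    then show "t \<in> spectrum L \<longleftrightarrow> t \<in> ?R"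
    proof cases
      case 1
      then show ?thesis unfolding R specL specL' t using m2 no2 n specL'[of 2] by auto
    next
      case 2
      then show ?thesis unfolding R specL specL' t using mn N' by auto
    next
      case 3
      then show ?thesis unfolding R specL specL' t gen[OF 3] using m0 gen[of 0] n specL'[of x] by auto
    qed
  qed
  have pos: "\<forall>x \<in> spectrum L' - {0}. eigenvalue_mult L (x / (real n - 1)) = eigenvalue_mult L' x"
  proof
    fix x assume "x \<in> spectrum L' - {0}"
    then have "x \<noteq> 2" "x \<noteq> real n" using specL'[of x] no2 non by auto
    then show "eigenvalue_mult L (x / (real n - 1)) = eigenvalue_mult L' x" by (rule gen)
  qed
  have diff: "int (eigenvalue_mult L (2 / (real n - 1))) = int E' - int N'" using m2 by simp
  have iter: "CL_iter n (r - 1) G = H" "CL_iter n r G = CL n H" by (simp_all add: q H_def)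
  show ?thesis
    unfolding Let_def iter L_def[symmetric] L'_def[symmetric] N'_def[symmetric] E'_def[symmetric]
    using spec pos m0 diff mn by (intro conjI)
qed

end
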